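(* Let $\mathcal H$ be a Hilbert space and let $\{P_1,P_2\}$ be a pair of orthogonal projections on $\mathcal H$ associated with two $m$-dimensional isoclinic subspaces (that is, $P_1$ and $P_2$ are the orthogonal projections of $\mathcal H$ onto these two subspaces). Then each of the subspaces $P_1\mathcal H$ and $P_2\mathcal H$ is correctable for the error model $\{\frac{1}{\sqrt2}P_i\}_{i=1}^2$.
   Context: Error models and quantum channels. An error model is a set $\{E_i\}$ of operators on a Hilbert space $\mathcal H$ satisfying $\sum_iE_i^*E_i\le I$; this condition ensures that the completely positive map $\mathcal E(\rho)=\sum_iE_i\rho E_i^*$, called a quantum channel in this context, is trace non-increasing. Correctable. A quantum code is a subspace $\mathcal C$ of $\mathcal H$. The code $\mathcal C$ is correctable for $\mathcal E$ (equivalently, for the error model $\{E_i\}$) if there is another quantum channel $\mathcal R$ on $\mathcal H$ such that $(\mathcal R\circ\mathcal E)(\rho)=\rho$ for all density operators $\rho$ supported on $\mathcal C$. Canonical angles. Let $\mathcal V,\mathcal W$ be finite-dimensional subspaces of $\mathcal H$ and $l=\min\{\dim\mathcal V,\dim\mathcal W\}$. The canonical angles $\theta_1,\dots,\theta_l\in[0,\frac{\pi}{2}]$ between $\mathcal V$ and $\mathcal W$ are defined recursively: for $k=1,\dots,l$, $\theta_k$ is the unique number in $[0,\frac{\pi}{2}]$ with $$\cos(\theta_k)=\max\{|\langle x,y\rangle| : x\in\mathcal V\cap\{x_1,\dots,x_{k-1}\}^\perp,\ y\in\mathcal W\cap\{y_1,\dots,y_{k-1}\}^\perp,\ \|x\|=\|y\|=1\},$$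 where $x_j\in\mathcal V$, $y_j\in\mathcal W$ ($j<k$) are unit vectors chosen so that the $j$-th maximum is attained at $(x_j,y_j)$ (for $k=1$ there are no orthogonality constraints). Isoclinic subspaces. Two $m$-dimensional subspaces of $\mathcal H$ ($1\le m\le\dim\mathcal H$) are isoclinic if all $m$ canonical angles between them are equal.
   Formalization: Correctable is read as (R∘E)(ρ) = tr(E(ρ))·ρ with tr(E(ρ)) > 0, instead of (R∘E)(ρ) = ρ; the literal equation fails, e.g. for two orthogonal lines, since E(ρ) then has trace 1/2 and R cannot increase the trace. *)

theory Defs
  imports "HOL-Analysis.Analysis"
begin

text \<open>The inner product is antilinear in its first argument; completeness comes from
  the class \<^class>\<open>banach\<close>.\<close>

class chilbert_space = banach +
  fixes scaleC :: "complex \<Rightarrow> 'a \<Rightarrow> 'a"  (infixr \<open>*\<^sub>C\<close> 75)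
    and cinner :: "'a \<Rightarrow> 'a \<Rightarrow> complex"
  assumes scaleC_add_right: "a *\<^sub>C (x + y) = a *\<^sub>C x + a *\<^sub>C y"
    and scaleC_add_left: "(a + b) *\<^sub>C x = a *\<^sub>C x + b *\<^sub>C x"
    and scaleC_scaleC: "a *\<^sub>C b *\<^sub>C x = (a * b) *\<^sub>C x"
    and scaleC_one: "1 *\<^sub>C x = x"
    and scaleR_scaleC: "r *\<^sub>R x = complex_of_real r *\<^sub>C x"
    and cinner_commute: "cinner x y = cnj (cinner y x)"
    and cinner_add_right: "cinner x (y + z) = cinner x y + cinner x z"
    and cinner_scaleC_right: "cinner x (a *\<^sub>C y) = a * cinner x y"
    and cinner_self: "cinner x x = complex_of_real ((norm x)\<^sup>2)"

global_interpretation complex_vector: vector_space "scaleC :: complex \<Rightarrow> 'a \<Rightarrow> 'a::chilbert_space"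
  by standard (simp_all add: scaleC_add_right scaleC_add_left scaleC_scaleC scaleC_one)

text \<open>A bounded operator is a \<^typ>\<open>'a \<Rightarrow>\<^sub>L 'a\<close> (bounded and real-linear)
  that is moreover complex-linear.\<close>

definition clinear_op :: "('a::chilbert_space \<Rightarrow>\<^sub>L 'a) \<Rightarrow> bool" where
  "clinear_op A \<longleftrightarrow> (\<forall>c x. A (c *\<^sub>C x) = c *\<^sub>C A x)"

definition cadjoint :: "('a::chilbert_space \<Rightarrow>\<^sub>L 'a) \<Rightarrow> ('a \<Rightarrow>\<^sub>L 'a)" where
  "cadjoint A = (THE B :: 'a \<Rightarrow>\<^sub>L 'a. \<forall>x y. cinner (A x) y = cinner x (B y))"

definition positive_op :: "('a::chilbert_space \<Rightarrow>\<^sub>L 'a) \<Rightarrow> bool" where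
  "positive_op A \<longleftrightarrow> clinear_op A \<and> (\<forall>x. cinner x (A x) \<in> \<real>\<^sub>\<ge>\<^sub>0)"

definition orth_projection_onto :: "('a::chilbert_space \<Rightarrow>\<^sub>L 'a) \<Rightarrow> 'a set \<Rightarrow> bool" where
  "orth_projection_onto P V \<longleftrightarrow>
     clinear_op P \<and> P o\<^sub>L P = P \<and> (\<forall>x y. cinner (P x) y = cinner x (P y)) \<and> range P = V"

definition orthonormal_basis :: "'a::chilbert_space set \<Rightarrow> bool" where
  "orthonormal_basis B \<longleftrightarrow>
     (\<forall>e\<in>B. \<forall>f\<in>B. cinner e f = (if e = f then 1 else 0)) \<and>
     closure (complex_vector.span B) = UNIV"

text \<open>Used only for positive operators, for which the sum does not depend on the
  orthonormal basis.\<close>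

definition has_trace :: "('a::chilbert_space \<Rightarrow>\<^sub>L 'a) \<Rightarrow> complex \<Rightarrow> bool" where
  "has_trace T t \<longleftrightarrow> (\<exists>B. orthonormal_basis B \<and> ((\<lambda>e. cinner e (T e)) has_sum t) B)"

definition density_operator :: "('a::chilbert_space \<Rightarrow>\<^sub>L 'a) \<Rightarrow> bool" where
  "density_operator \<rho> \<longleftrightarrow> positive_op \<rho> \<and> has_trace \<rho> 1"

definition supported_on :: "('a::chilbert_space \<Rightarrow>\<^sub>L 'a) \<Rightarrow> 'a set \<Rightarrow> bool" where
  "supported_on \<rho> C \<longleftrightarrow> range \<rho> \<subseteq> C"

text \<open>An error model is a finite or countably infinite family (not a set: equal operators
  count with multiplicity).  The inequality \<open>\<Sum>\<^sub>i E\<^sub>i\<^sup>* E\<^sub>i \<le> I\<close> is stated for all finite partial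
  sums, which is what it means for an infinite family and is equivalent to the inequality
  for the full sum when the family is finite.\<close>

definition error_model :: "nat set \<Rightarrow> (nat \<Rightarrow> ('a::chilbert_space \<Rightarrow>\<^sub>L 'a)) \<Rightarrow> bool" where
  "error_model I E \<longleftrightarrow>
     (\<forall>i\<in>I. clinear_op (E i)) \<and>
     (\<forall>F. finite F \<and> F \<subseteq> I \<longrightarrow> positive_op (id_blinfun - (\<Sum>i\<in>F. cadjoint (E i) o\<^sub>L E i)))"

text \<open>For an infinite family the sum converges in operator norm whenever \<open>\<rho>\<close> is trace
  class; the value elsewhere is immaterial.\<close>

definition kraus_map ::
  "nat set \<Rightarrow> (nat \<Rightarrow> ('a::chilbert_space \<Rightarrow>\<^sub>L 'a)) \<Rightarrow> ('a \<Rightarrow>\<^sub>L 'a) \<Rightarrow> ('a \<Rightarrow>\<^sub>L 'a)" where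
  "kraus_map I E \<rho> = (\<Sum>\<^sub>\<infinity>i\<in>I. E i o\<^sub>L \<rho> o\<^sub>L cadjoint (E i))"

definition quantum_channel :: "(('a::chilbert_space \<Rightarrow>\<^sub>L 'a) \<Rightarrow> ('a \<Rightarrow>\<^sub>L 'a)) \<Rightarrow> bool" where
  "quantum_channel \<Phi> \<longleftrightarrow> (\<exists>I E. error_model I E \<and> \<Phi> = kraus_map I E)"

text \<open>Channels may decrease the trace, so that the output \<open>\<Phi> \<rho>\<close> of a density operator is in
  general an unnormalised state, occurring with probability \<open>t = tr (\<Phi> \<rho>)\<close>.  Recovery means
  that \<open>R\<close> sends the normalised output \<open>\<Phi> \<rho> / t\<close> to \<open>\<rho>\<close>.  If \<open>\<Phi>\<close> preserves the trace on the
  code, this is \<open>R (\<Phi> \<rho>) = \<rho>\<close> (see the lemma below).  The unnormalised equation cannot be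
  demanded in general: \<open>R\<close> is itself trace non-increasing, so it would force \<open>t = 1\<close>, and no
  channel that loses trace on the code could be corrected.\<close>

definition correctable ::
  "'a::chilbert_space set \<Rightarrow> (('a \<Rightarrow>\<^sub>L 'a) \<Rightarrow> ('a \<Rightarrow>\<^sub>L 'a)) \<Rightarrow> bool" where
  "correctable C \<Phi> \<longleftrightarrow>
     complex_vector.subspace C \<and> quantum_channel \<Phi> \<and>
     (\<exists>R. quantum_channel R \<and>
        (\<forall>\<rho>. density_operator \<rho> \<and> supported_on \<rho> C \<longrightarrow>
           (\<exists>t>0. has_trace (\<Phi> \<rho>) (complex_of_real t) \<and> (R \<circ> \<Phi>) \<rho> = t *\<^sub>R \<rho>)))"

lemma correctable_iff_of_trace_preserving:
  assumes "\<And>\<rho> t. density_operator \<rho> \<Longrightarrow> supported_on \<rho> C \<Longrightarrow> has_trace (\<Phi> \<rho>) t \<longleftrightarrow> t = 1"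
  shows "correctable C \<Phi> \<longleftrightarrow>
     complex_vector.subspace C \<and> quantum_channel \<Phi> \<and>
     (\<exists>R. quantum_channel R \<and>
        (\<forall>\<rho>. density_operator \<rho> \<and> supported_on \<rho> C \<longrightarrow> (R \<circ> \<Phi>) \<rho> = \<rho>))"
proof -
  have "(\<exists>t>0. has_trace (\<Phi> \<rho>) (complex_of_real t) \<and> (R \<circ> \<Phi>) \<rho> = t *\<^sub>R \<rho>) \<longleftrightarrow> (R \<circ> \<Phi>) \<rho> = \<rho>"
    if "density_operator \<rho> \<and> supported_on \<rho> C" for \<rho> R
    using that assms[of \<rho>] by (auto intro!: exI[of _ "1::real"])
  then show ?thesis
    unfolding correctable_def by (metis (no_types, lifting))
qed

definition correctable_for_error_model ::
  "'a::chilbert_space set \<Rightarrow> nat set \<Rightarrow> (nat \<Rightarrow> ('a \<Rightarrow>\<^sub>L 'a)) \<Rightarrow> bool" where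
  "correctable_for_error_model C I E \<longleftrightarrow> error_model I E \<and> correctable C (kraus_map I E)"

text \<open>The pairs over which the \<open>k\<close>-th maximum is taken, given the earlier choices
  \<open>x j\<close>, \<open>y j\<close> for \<open>1 \<le> j < k\<close>.\<close>

definition angle_pairs ::
  "'a::chilbert_space set \<Rightarrow> 'a set \<Rightarrow> (nat \<Rightarrow> 'a) \<Rightarrow> (nat \<Rightarrow> 'a) \<Rightarrow> nat \<Rightarrow> ('a \<times> 'a) set" where
  "angle_pairs V W x y k =
     {(u, v). u \<in> V \<and> v \<in> W \<and> norm u = 1 \<and> norm v = 1 \<and>
        (\<forall>j\<in>{1..<k}. cinner (x j) u = 0 \<and> cinner (y j) v = 0)}"

text \<open>\<open>\<theta> 1, \<dots>, \<theta> l\<close> are the canonical angles: there are successive choices of maximisers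
  producing them.  The resulting angles do not depend on these choices.\<close>

definition canonical_angles ::
  "'a::chilbert_space set \<Rightarrow> 'a set \<Rightarrow> (nat \<Rightarrow> real) \<Rightarrow> bool" where
  "canonical_angles V W \<theta> \<longleftrightarrow>
     (\<exists>x y. \<forall>k\<in>{1..min (complex_vector.dim V) (complex_vector.dim W)}.
        \<theta> k \<in> {0..pi/2} \<and>
        (x k, y k) \<in> angle_pairs V W x y k \<and>
        cos (\<theta> k) = cmod (cinner (x k) (y k)) \<and>
        (\<forall>(u, v)\<in>angle_pairs V W x y k. cmod (cinner u v) \<le> cos (\<theta> k)))"

text \<open>As \<^term>\<open>complex_vector.dim\<close> is \<open>0\<close> on infinite-dimensional subspaces, \<open>1 \<le> m\<close> makes
  both subspaces finite-dimensional.\<close>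

definition isoclinic :: "nat \<Rightarrow> 'a::chilbert_space set \<Rightarrow> 'a set \<Rightarrow> bool" where
  "isoclinic m V W \<longleftrightarrow>
     1 \<le> m \<and>
     complex_vector.subspace V \<and> complex_vector.dim V = m \<and>
     complex_vector.subspace W \<and> complex_vector.dim W = m \<and>
     (\<exists>\<theta>. canonical_angles V W \<theta> \<and> (\<forall>j\<in>{1..m}. \<forall>k\<in>{1..m}. \<theta> j = \<theta> k))"

end

theory Submission
  imports Defs
begin

text \<open>Write \<open>P\<close>, \<open>Q\<close> for the two projections and \<open>c = cos\<^sup>2 \<theta>\<close> for the common canonical angle
  \<open>\<theta>\<close>.  The geometric core is that isoclinic subspaces satisfy \<open>PQP = cP\<close> and \<open>QPQ = cQ\<close>
  (\<open>isoclinic_compression\<close>): the first maximum says that no unit vectors of the two subspaces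
  overlap by more than \<open>cos \<theta>\<close>, and equality of the angles says that every pair of principal
  vectors attains this bound, so each projection sends a principal vector to a multiple of its
  partner.

  The relation \<open>PQP = cP\<close> is the Knill-Laflamme condition for the code \<open>range P\<close> and the errors
  \<open>P/\<surd>2\<close>, \<open>Q/\<surd>2\<close>, and it yields an explicit recovery.  On the code, \<open>P\<close> acts as the identity,
  while \<open>Q = cP + (1 - P)Q\<close> splits into a multiple of the identity and a part with values in
  the orthogonal complement of the code.  Since
  \<open>PQ(1 - P)QP = c(1 - c)P\<close>, that second part is \<open>\<surd>(c(1 - c))\<close> times an isometry on the code.
  The recovery measures whether the state lies in the code and, if it does not, undoes this
  isometry: its operators are \<open>P\<close> and \<open>A = PQ(1 - P)/\<surd>(c(1 - c))\<close>.  For a state \<open>\<rho>\<close> on the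
  code, the three contributions add up to
  \<open>(1/2 + c\<^sup>2/2 + c(1 - c)/2) \<rho> = ((1 + c)/2) \<rho>\<close> (\<open>recovery_channel\<close>).  The factor
  \<open>(1 + c)/2\<close> is also the trace of the damaged state, because \<open>tr (Q\<rho>Q) = tr (\<rho>PQP) = c tr \<rho>\<close>
  (\<open>trace_projected_state\<close>).

  The trace is computed in an arbitrary orthonormal basis of a possibly infinite-dimensional
  space.  As a state on the code has finite rank, Parseval's identity reduces it to a finite
  sum over an orthonormal basis of the code.\<close>


section \<open>Inner products\<close>

lemma cinner_add_left: "cinner (x + y) z = cinner x z + cinner (y :: 'a::chilbert_space) z"
  by (metis cinner_add_right cinner_commute complex_cnj_add)

lemma cinner_scaleC_left: "cinner (a *\<^sub>C x) y = cnj a * cinner x (y :: 'a::chilbert_space)"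
  by (metis cinner_commute cinner_scaleC_right complex_cnj_mult)

lemma cinner_scaleR_right: "cinner x (r *\<^sub>R y) = of_real r * cinner x (y :: 'a::chilbert_space)"
  by (simp add: scaleR_scaleC cinner_scaleC_right)

lemma cinner_scaleR_left: "cinner (r *\<^sub>R x) y = of_real r * cinner x (y :: 'a::chilbert_space)"
  by (simp add: scaleR_scaleC cinner_scaleC_left)

lemma cinner_zero_right [simp]: "cinner x (0 :: 'a::chilbert_space) = 0"
  using cinner_scaleR_right[of x 0 0] by simp

lemma cinner_zero_left [simp]: "cinner (0 :: 'a::chilbert_space) x = 0"
  using cinner_scaleR_left[of 0 0 x] by simp

lemma cinner_minus_right: "cinner x (- y) = - cinner x (y :: 'a::chilbert_space)"
  using cinner_scaleR_right[of x "-1" y] by simp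

lemma cinner_minus_left: "cinner (- x) y = - cinner x (y :: 'a::chilbert_space)"
  using cinner_scaleR_left[of "-1" x y] by simp

lemma cinner_diff_right: "cinner x (y - z) = cinner x y - cinner x (z :: 'a::chilbert_space)"
  using cinner_add_right[of x y "- z"] by (simp add: cinner_minus_right)

lemma cinner_diff_left: "cinner (x - y) z = cinner x z - cinner (y :: 'a::chilbert_space) z"
  using cinner_add_left[of x "- y" z] by (simp add: cinner_minus_left)

lemma cinner_sum_right: "cinner x (\<Sum>i\<in>I. f i) = (\<Sum>i\<in>I. cinner x (f i :: 'a::chilbert_space))"
  by (induction I rule: infinite_finite_induct) (simp_all add: cinner_add_right)

lemmas cinner_simps = cinner_add_left cinner_add_right cinner_diff_left cinner_diff_right
  cinner_scaleC_left cinner_scaleC_right cinner_scaleR_left cinner_scaleR_right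

lemma cinner_self_eq_0: "cinner x x = 0 \<longleftrightarrow> (x :: 'a::chilbert_space) = 0"
  by (simp add: cinner_self)

lemma cinner_eqI:
  assumes "\<And>z. cinner z x = cinner z y"
  shows "x = (y :: 'a::chilbert_space)"
  using assms[of "x - y"] cinner_self_eq_0[of "x - y"] by (simp add: cinner_diff_right)

lemma pythagoras:
  assumes "cinner x y = 0"
  shows "(norm (x + y))\<^sup>2 = (norm x)\<^sup>2 + (norm (y :: 'a::chilbert_space))\<^sup>2"
proof -
  have "cinner y x = 0" using assms cinner_commute[of y x] by simp
  then have "complex_of_real ((norm (x + y))\<^sup>2) = complex_of_real ((norm x)\<^sup>2 + (norm y)\<^sup>2)"
    unfolding cinner_self[symmetric] of_real_add using assms by (simp add: cinner_simps)
  then show ?thesis by (simp only: of_real_eq_iff)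
qed

lemma norm_scaleC: "norm (a *\<^sub>C x) = cmod a * norm (x :: 'a::chilbert_space)"
proof -
  have "complex_of_real ((norm (a *\<^sub>C x))\<^sup>2) = (a * cnj a) * cinner x x"
    unfolding cinner_self[symmetric] by (simp add: cinner_simps)
  also have "\<dots> = complex_of_real ((cmod a * norm x)\<^sup>2)"
    unfolding cinner_self complex_norm_square[symmetric] by (simp add: power_mult_distrib)
  finally have "(norm (a *\<^sub>C x))\<^sup>2 = (cmod a * norm x)\<^sup>2" by (simp only: of_real_eq_iff)
  then show ?thesis by (simp add: power2_eq_iff_nonneg)
qed

lemma cauchy_schwarz: "cmod (cinner x y) \<le> norm x * norm (y :: 'a::chilbert_space)"
proof (cases "x = 0")
  case False
  define a where "a = cinner x y / cinner x x"
  have "cinner x (y - a *\<^sub>C x) = 0"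
    using False by (simp add: a_def cinner_simps cinner_self_eq_0)
  then have "cinner (a *\<^sub>C x) (y - a *\<^sub>C x) = 0" by (simp add: cinner_scaleC_left)
  from pythagoras[OF this] have "(norm (a *\<^sub>C x))\<^sup>2 \<le> (norm y)\<^sup>2" by simp
  then have *: "norm (a *\<^sub>C x) \<le> norm y" by (simp add: power2_le_iff_abs_le)
  have "cmod (cinner x y) = cmod a * norm x * norm x"
    using False by (simp add: a_def cinner_self norm_divide norm_power norm_mult power2_eq_square)
  then show ?thesis using * by (metis norm_scaleC mult.commute mult_left_mono norm_ge_zero)
qed simp

lemma bounded_linear_cinner: "bounded_linear (cinner (x :: 'a::chilbert_space))"
proof (rule bounded_linear_intro)
  show "norm (cinner x y) \<le> norm y * norm x" for y
    using cauchy_schwarz[of x y] by (simp add: mult.commute)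
qed (simp_all add: cinner_simps scaleR_conv_of_real)


section \<open>Orthonormal sets and Parseval's identity\<close>

definition orthonormal_set :: "'a::chilbert_space set \<Rightarrow> bool" where
  "orthonormal_set B \<longleftrightarrow> (\<forall>e\<in>B. \<forall>f\<in>B. cinner e f = (if e = f then 1 else 0))"

lemma orthonormal_set_subset: "orthonormal_set B \<Longrightarrow> A \<subseteq> B \<Longrightarrow> orthonormal_set A"
  unfolding orthonormal_set_def by blast

lemma cinner_span_eq_0:
  assumes "y \<in> complex_vector.span F" and "\<And>e. e \<in> F \<Longrightarrow> cinner e z = 0"
  shows "cinner y (z :: 'a::chilbert_space) = 0"
  using assms(1)
proof (induction rule: complex_vector.span_induct)
  show "complex_vector.subspace {y. cinner y z = 0}"
    unfolding complex_vector.subspace_def by (simp add: cinner_simps)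
qed (use assms(2) in simp)

text \<open>The error \<open>x - s\<close> of the expansion \<open>s\<close> is orthogonal to the span, hence to \<open>s - y\<close>, and
  Pythagoras applies to \<open>x - y = (s - y) + (x - s)\<close>.\<close>

lemma orthonormal_expansion_best:
  assumes "orthonormal_set F" "finite F" and "y \<in> complex_vector.span F"
  shows "norm (x - (\<Sum>e\<in>F. cinner e x *\<^sub>C e)) \<le> norm (x - (y :: 'a::chilbert_space))"
proof -
  define s where "s = (\<Sum>e\<in>F. cinner e x *\<^sub>C e)"
  have "cinner e (x - s) = 0" if "e \<in> F" for e
  proof -
    have "cinner e s = (\<Sum>f\<in>F. if e = f then cinner e x else 0)"
      unfolding s_def cinner_sum_right using that assms(1)
      by (intro sum.cong) (auto simp: cinner_scaleC_right orthonormal_set_def)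
    then show ?thesis using that assms(2) by (simp add: cinner_diff_right)
  qed
  moreover have "s - y \<in> complex_vector.span F"
    unfolding s_def
    by (intro complex_vector.span_diff[OF _ assms(3)] complex_vector.span_sum
        complex_vector.span_scale complex_vector.span_base)
  ultimately have "cinner (s - y) (x - s) = 0" by (rule cinner_span_eq_0[rotated])
  from pythagoras[OF this] have "(norm (x - s))\<^sup>2 \<le> (norm (x - y))\<^sup>2" by simp
  then show ?thesis unfolding s_def by (simp add: power2_le_iff_abs_le)
qed

lemma orthonormal_expansion:
  assumes "orthonormal_set F" "finite F" and "x \<in> complex_vector.span F"
  shows "(\<Sum>e\<in>F. cinner e x *\<^sub>C e) = (x :: 'a::chilbert_space)"
  using orthonormal_expansion_best[OF assms, of x] by simp

lemma orthonormal_independent: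
  assumes "orthonormal_set F"
  shows "complex_vector.independent (F :: 'a::chilbert_space set)"
  unfolding complex_vector.dependent_def
proof (safe)
  fix e assume e: "e \<in> F" "e \<in> complex_vector.span (F - {e})"
  have "cinner e e = 0"
    by (rule cinner_span_eq_0[OF e(2)]) (use assms e in \<open>auto simp: orthonormal_set_def\<close>)
  with e assms show False by (simp add: orthonormal_set_def)
qed

text \<open>A vector of \<open>V\<close> outside the span of \<open>X\<close> would extend \<open>X\<close> to an independent set with more
  elements than a basis of \<open>V\<close>.  As \<open>X\<close> is finite and nonempty, the dimension is positive, which
  excludes the value \<open>0\<close> that \<^const>\<open>complex_vector.dim\<close> takes on infinite-dimensional
  subspaces.\<close>

lemma span_independent_eq:
  assumes "complex_vector.subspace V" "complex_vector.dim V = card X" "X \<noteq> {}" "finite X"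
    and "complex_vector.independent X" "X \<subseteq> (V :: 'a::chilbert_space set)"
  shows "complex_vector.span X = V"
proof -
  obtain b where b: "b \<subseteq> V" "complex_vector.independent b" "V \<subseteq> complex_vector.span b"
      "card b = complex_vector.dim V"
    using complex_vector.basis_exists by blast
  have "card b > 0" using assms b by (simp add: card_gt_0_iff)
  then have fb: "finite b" by (simp add: card_gt_0_iff)
  have "v \<in> complex_vector.span X" if "v \<in> V" for v
  proof (rule ccontr)
    assume v: "v \<notin> complex_vector.span X"
    then have "v \<notin> X" using complex_vector.span_base by blast
    then have "card (insert v X) = Suc (card b)" using assms b by simp
    moreover have "card (insert v X) \<le> card b"
      using complex_vector.independent_span_bound[OF fb
          complex_vector.independent_insertI[OF v assms(5)]] assms(6) b(3) that by blast
    ultimately show False by simp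
  qed
  then show ?thesis using complex_vector.span_minimal[OF assms(6,1)] by blast
qed

text \<open>The span of the basis is dense, so some finite linear combination comes within \<open>\<epsilon>\<close> of \<open>x\<close>;
  by best approximation every finite partial sum over a larger index set does at least as well.\<close>

lemma orthonormal_basis_has_sum:
  assumes "orthonormal_basis (B :: 'a::chilbert_space set)"
  shows "((\<lambda>e. cinner e x *\<^sub>C e) has_sum x) B"
proof -
  have ON: "orthonormal_set B" and cl: "closure (complex_vector.span B) = UNIV"
    using assms unfolding orthonormal_basis_def orthonormal_set_def by auto
  show ?thesis unfolding has_sum_def
  proof (rule tendstoI)
    fix \<epsilon> :: real assume "\<epsilon> > 0"
    then obtain y where y: "y \<in> complex_vector.span B" "dist y x < \<epsilon>"
      using cl closure_approachable[of x "complex_vector.span B"] by auto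
    obtain F where F: "finite F" "F \<subseteq> B" "y \<in> complex_vector.span F"
    proof -
      obtain F g where F: "finite F" "F \<subseteq> B" "y = (\<Sum>e\<in>F. g e *\<^sub>C e)"
        using y(1) unfolding complex_vector.span_explicit by blast
      moreover have "y \<in> complex_vector.span F"
        unfolding F(3) by (intro complex_vector.span_sum complex_vector.span_scale
            complex_vector.span_base)
      ultimately show thesis using that by blast
    qed
    show "\<forall>\<^sub>F G in finite_subsets_at_top B. dist (\<Sum>e\<in>G. cinner e x *\<^sub>C e) x < \<epsilon>"
      unfolding eventually_finite_subsets_at_top
    proof (intro exI conjI allI impI)
      fix G assume G: "finite G \<and> F \<subseteq> G \<and> G \<subseteq> B"
      have "norm (x - (\<Sum>e\<in>G. cinner e x *\<^sub>C e)) \<le> norm (x - y)"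
        using G F(3) complex_vector.span_mono[of F G]
        by (intro orthonormal_expansion_best orthonormal_set_subset[OF ON]) auto
      then show "dist (\<Sum>e\<in>G. cinner e x *\<^sub>C e) x < \<epsilon>"
        using y(2) by (simp add: dist_norm norm_minus_commute)
    qed (use F in auto)
  qed
qed

lemma parseval:
  assumes "orthonormal_basis (B :: 'a::chilbert_space set)"
  shows "((\<lambda>e. cinner u e * cinner e v) has_sum cinner u v) B"
  using has_sum_bounded_linear[OF bounded_linear_cinner[of u] orthonormal_basis_has_sum[OF assms, of v]]
  by (simp add: o_def cinner_scaleC_right mult.commute)

lemma has_sum_finite_sum:
  fixes f :: "'i \<Rightarrow> 'b \<Rightarrow> 'c::topological_comm_monoid_add"
  assumes "\<And>k. k \<in> K \<Longrightarrow> (f k has_sum s k) B"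
  shows "((\<lambda>e. \<Sum>k\<in>K. f k e) has_sum (\<Sum>k\<in>K. s k)) B"
  using assms by (induction K rule: infinite_finite_induct) (auto intro!: has_sum_add)

text \<open>The trace of \<open>\<Sum>\<^sub>k |a\<^sub>k\<rangle>\<langle>b\<^sub>k|\<close> is the same in every orthonormal basis.  This is how the
  basis that witnesses the trace of a density operator, about which nothing is known, is
  eliminated.\<close>

lemma trace_finite_rank:
  fixes T :: "'a::chilbert_space \<Rightarrow>\<^sub>L 'a"
  assumes "orthonormal_basis B" "finite K" and "\<And>z. T z = (\<Sum>k\<in>K. cinner (b k) z *\<^sub>C a k)"
  shows "((\<lambda>e. cinner e (T e)) has_sum (\<Sum>k\<in>K. cinner (b k) (a k))) B"
  unfolding assms(3) cinner_sum_right cinner_scaleC_right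
  by (intro has_sum_finite_sum parseval assms)


section \<open>Operators\<close>

lemma clinear_op_id: "clinear_op id_blinfun"
  by (simp add: clinear_op_def)

lemma clinear_op_compose: "clinear_op A \<Longrightarrow> clinear_op B \<Longrightarrow> clinear_op (A o\<^sub>L B)"
  by (simp add: clinear_op_def)

lemma clinear_op_diff: "clinear_op A \<Longrightarrow> clinear_op B \<Longrightarrow> clinear_op (A - B)"
  by (simp add: clinear_op_def blinfun.bilinear_simps complex_vector.scale_right_diff_distrib)

lemma clinear_op_scaleR: "clinear_op A \<Longrightarrow> clinear_op (r *\<^sub>R A)"
  by (simp add: clinear_op_def blinfun.bilinear_simps scaleR_scaleC scaleC_scaleC mult.commute)

lemma clinear_op_sum: "(\<And>i. i \<in> I \<Longrightarrow> clinear_op (A i)) \<Longrightarrow> clinear_op (\<Sum>i\<in>I. A i)"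
  by (simp add: clinear_op_def blinfun.sum_left complex_vector.scale_sum_right)

text \<open>An explicit witness for the adjoint.  As \<^const>\<open>cadjoint\<close> is a definite description, it means
  something only once an adjoint is known to exist; carrying a witness replaces the Riesz
  representation theorem.\<close>

definition adjoint_pair :: "('a::chilbert_space \<Rightarrow>\<^sub>L 'a) \<Rightarrow> ('a \<Rightarrow>\<^sub>L 'a) \<Rightarrow> bool" where
  "adjoint_pair A B \<longleftrightarrow> clinear_op A \<and> clinear_op B \<and> (\<forall>x y. cinner (A x) y = cinner x (B y))"

lemma adjoint_pair_swap: "adjoint_pair A B \<Longrightarrow> adjoint_pair B A"
  unfolding adjoint_pair_def by (metis cinner_commute)

lemma cadjoint_eqI: "adjoint_pair A B \<Longrightarrow> cadjoint A = B"
  unfolding cadjoint_def adjoint_pair_def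
  by (intro the_equality blinfun_eqI cinner_eqI) (metis)+

lemma adjoint_pair_compose:
  "adjoint_pair A A' \<Longrightarrow> adjoint_pair B B' \<Longrightarrow> adjoint_pair (A o\<^sub>L B) (B' o\<^sub>L A')"
  by (simp add: adjoint_pair_def clinear_op_compose)

lemma adjoint_pair_id: "adjoint_pair id_blinfun id_blinfun"
  by (simp add: adjoint_pair_def clinear_op_id)

lemma adjoint_pair_diff:
  "adjoint_pair A A' \<Longrightarrow> adjoint_pair B B' \<Longrightarrow> adjoint_pair (A - B) (A' - B')"
  by (simp add: adjoint_pair_def clinear_op_diff blinfun.bilinear_simps cinner_simps)

lemma adjoint_pair_scaleR:
  "adjoint_pair A A' \<Longrightarrow> adjoint_pair (r *\<^sub>R A) (r *\<^sub>R A')"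
  by (simp add: adjoint_pair_def clinear_op_scaleR blinfun.bilinear_simps cinner_simps)

lemma adjoint_pair_projection: "orth_projection_onto P V \<Longrightarrow> adjoint_pair P P"
  by (simp add: adjoint_pair_def orth_projection_onto_def)

lemma projection_idem: "orth_projection_onto P V \<Longrightarrow> P (P x) = P x"
  unfolding orth_projection_onto_def by (metis blinfun_apply_blinfun_compose)

lemma projection_fixes: "orth_projection_onto P V \<Longrightarrow> x \<in> V \<Longrightarrow> P x = x"
  using projection_idem[of P V] unfolding orth_projection_onto_def by (metis rangeE)

lemma projection_range: "orth_projection_onto P V \<Longrightarrow> P x \<in> V"
  unfolding orth_projection_onto_def by auto

lemma projection_cinner: "orth_projection_onto P V \<Longrightarrow> cinner (P x) y = cinner x (P y)"
  by (simp add: orth_projection_onto_def)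

lemma norm_adjoint:
  "adjoint_pair A A' \<Longrightarrow> cinner x (A' (A x)) = complex_of_real ((norm (A x))\<^sup>2)"
  unfolding adjoint_pair_def by (metis cinner_self)

lemma projection_contraction: "orth_projection_onto P V \<Longrightarrow> norm (P x) \<le> norm x"
proof -
  assume P: "orth_projection_onto P V"
  have "cinner (P x) (x - P x) = 0"
    by (simp add: projection_cinner[OF P] blinfun.bilinear_simps projection_idem[OF P])
  from pythagoras[OF this] have "(norm (P x))\<^sup>2 \<le> (norm x)\<^sup>2" by simp
  then show ?thesis by (simp add: power2_le_iff_abs_le)
qed

text \<open>With adjoints at hand, \<open>\<langle>x, (1 - \<Sum> E\<^sub>i\<^sup>* E\<^sub>i) x\<rangle> = \<parallel>x\<parallel>\<^sup>2 - \<Sum> \<parallel>E\<^sub>i x\<parallel>\<^sup>2\<close>, so the operator inequality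
  is an inequality of norms, and it passes from the whole family to its subfamilies.\<close>

lemma error_modelI:
  assumes "finite I" and adj: "\<And>i. i \<in> I \<Longrightarrow> adjoint_pair (E i) (E' i)"
    and le: "\<And>x. (\<Sum>i\<in>I. (norm (E i x))\<^sup>2) \<le> (norm x)\<^sup>2"
  shows "error_model I E"
  unfolding error_model_def
proof (intro conjI ballI allI impI)
  show "clinear_op (E i)" if "i \<in> I" for i using adj[OF that] by (simp add: adjoint_pair_def)
next
  fix F assume F: "finite F \<and> F \<subseteq> I"
  have adj': "adjoint_pair (E i) (cadjoint (E i))" if "i \<in> F" for i
    using adj[of i] cadjoint_eqI[OF adj[of i]] that F by auto
  show "positive_op (id_blinfun - (\<Sum>i\<in>F. cadjoint (E i) o\<^sub>L E i))"
    unfolding positive_op_def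
  proof (intro conjI allI)
    show "clinear_op (id_blinfun - (\<Sum>i\<in>F. cadjoint (E i) o\<^sub>L E i))"
      using adj' by (intro clinear_op_diff clinear_op_id clinear_op_sum clinear_op_compose)
        (auto simp: adjoint_pair_def)
    fix x
    have "(\<Sum>i\<in>F. cinner x (cadjoint (E i) (E i x))) = (\<Sum>i\<in>F. complex_of_real ((norm (E i x))\<^sup>2))"
      by (intro sum.cong refl norm_adjoint adj')
    then have "cinner x ((id_blinfun - (\<Sum>i\<in>F. cadjoint (E i) o\<^sub>L E i)) x)
      = complex_of_real ((norm x)\<^sup>2 - (\<Sum>i\<in>F. (norm (E i x))\<^sup>2))"
      by (simp add: blinfun.bilinear_simps blinfun.sum_left cinner_simps cinner_sum_right cinner_self)
    moreover have "(\<Sum>i\<in>F. (norm (E i x))\<^sup>2) \<le> (\<Sum>i\<in>I. (norm (E i x))\<^sup>2)"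
      using F assms(1) by (intro sum_mono2) auto
    ultimately show "cinner x ((id_blinfun - (\<Sum>i\<in>F. cadjoint (E i) o\<^sub>L E i)) x) \<in> \<real>\<^sub>\<ge>\<^sub>0"
      using le[of x] by (simp only: nonneg_Reals_of_real_iff)
  qed
qed

lemma kraus_map_pair:
  assumes "i \<noteq> j" "adjoint_pair (E i) A" "adjoint_pair (E j) B"
  shows "kraus_map {i, j} E \<rho> = (E i o\<^sub>L \<rho> o\<^sub>L A) + (E j o\<^sub>L \<rho> o\<^sub>L B)"
  using assms by (simp add: kraus_map_def cadjoint_eqI)

text \<open>Polarisation: as the quadratic form \<open>\<langle>z, Az\<rangle>\<close> is real at \<open>x + y\<close> and at \<open>x + \<i>y\<close>, the
  imaginary and the real part of \<open>\<langle>x, Ay\<rangle> - \<langle>Ax, y\<rangle>\<close> vanish.\<close>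

lemma positive_op_selfadjoint:
  assumes "positive_op A"
  shows "adjoint_pair A A"
  unfolding adjoint_pair_def
proof (intro conjI allI)
  show lin: "clinear_op A" "clinear_op A" using assms by (simp_all add: positive_op_def)
  fix x y
  have real: "Im (cinner z (A z)) = 0" for z
    using assms unfolding positive_op_def by (auto simp: complex_nonneg_Reals_iff)
  have "Im (cinner x (A y)) + Im (cinner y (A x)) = 0"
    using real[of "x + y"] real[of x] real[of y] by (simp add: cinner_simps blinfun.bilinear_simps)
  moreover have "Re (cinner x (A y)) - Re (cinner y (A x)) = 0"
    using real[of "x + \<i> *\<^sub>C y"] real[of x] real[of y] lin
    by (simp add: cinner_simps blinfun.bilinear_simps clinear_op_def)
  ultimately have "cinner x (A y) = cnj (cinner y (A x))"
    by (simp add: complex_eq_iff)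
  then show "cinner (A x) y = cinner x (A y)" by (metis cinner_commute)
qed


text \<open>That \<open>\<rho>\<close> is supported on \<open>V\<close> restricts only its range; self-adjointness transfers the
  restriction to the other side.\<close>

lemma supported_absorbs_projection:
  assumes P: "orth_projection_onto P V" and \<rho>: "adjoint_pair \<rho> \<rho>" "range \<rho> \<subseteq> V"
  shows "P (\<rho> z) = \<rho> z" "\<rho> (P z) = \<rho> z"
proof -
  show P\<rho>: "P (\<rho> z) = \<rho> z" for z using projection_fixes[OF P] \<rho>(2) by blast
  show "\<rho> (P z) = \<rho> z"
  proof (rule cinner_eqI)
    show "cinner u (\<rho> (P z)) = cinner u (\<rho> z)" for u
      using \<rho>(1) projection_cinner[OF P] P\<rho> unfolding adjoint_pair_def by metis
  qed
qed


section \<open>Isoclinic subspaces\<close>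

text \<open>The equality case of the Cauchy-Schwarz inequality: the bound forces \<open>\<parallel>Q x\<parallel> \<le> s\<close>, whereas the
  component of \<open>Q x\<close> along \<open>y\<close> already has norm \<open>s\<close>, so nothing is left orthogonal to \<open>y\<close>.\<close>

lemma projection_attaining_bound:
  fixes Q :: "'a::chilbert_space \<Rightarrow>\<^sub>L 'a"
  assumes Q: "orth_projection_onto Q W" and W: "complex_vector.subspace W"
    and bound: "\<And>v. v \<in> W \<Longrightarrow> norm v = 1 \<Longrightarrow> cmod (cinner x v) \<le> s" and "s \<ge> 0"
    and y: "y \<in> W" "norm y = 1" "cmod (cinner x y) = s"
  shows "Q x = cinner y x *\<^sub>C y"
proof -
  have "norm (Q x) \<le> s"
  proof (cases "Q x = 0")
    case False
    define v where "v = (1 / norm (Q x)) *\<^sub>R Q x"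
    have "v \<in> W" unfolding v_def scaleR_scaleC
      by (intro complex_vector.subspace_scale W projection_range[OF Q])
    moreover have "norm v = 1" using False by (simp add: v_def)
    ultimately have "cmod (cinner x v) \<le> s" by (rule bound)
    moreover have "cinner x (Q x) = complex_of_real ((norm (Q x))\<^sup>2)"
      using norm_adjoint[OF adjoint_pair_projection[OF Q], of x] by (simp add: projection_idem[OF Q])
    ultimately show ?thesis
      using False by (simp add: v_def cinner_simps norm_mult norm_power norm_divide power2_eq_square)
  qed (use \<open>s \<ge> 0\<close> in simp)
  define a where "a = cinner y x"
  have "cinner y (Q x) = a"
    using projection_cinner[OF Q, of y x] projection_fixes[OF Q y(1)] by (simp add: a_def)
  moreover have "cinner y y = 1" using y(2) by (simp add: cinner_self)
  ultimately have "cinner (a *\<^sub>C y) (Q x - a *\<^sub>C y) = 0" by (simp add: cinner_simps)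
  from pythagoras[OF this]
  have *: "(norm (Q x))\<^sup>2 = (norm (a *\<^sub>C y))\<^sup>2 + (norm (Q x - a *\<^sub>C y))\<^sup>2" by simp
  have "(norm (a *\<^sub>C y))\<^sup>2 = (cmod a)\<^sup>2" using y(2) by (simp add: norm_scaleC)
  moreover have "cmod a = s" using y(3) unfolding a_def by (metis cinner_commute complex_mod_cnj)
  moreover have "(norm (Q x))\<^sup>2 \<le> s\<^sup>2" using \<open>norm (Q x) \<le> s\<close> by (simp add: power_mono)
  ultimately have "(norm (Q x - a *\<^sub>C y))\<^sup>2 \<le> 0" using * by simp
  then show ?thesis by (simp add: a_def)
qed

lemma compression_eq_on_span:
  fixes P Q :: "'a::chilbert_space \<Rightarrow>\<^sub>L 'a"
  assumes "clinear_op P" "clinear_op Q"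
    and "\<And>x. x \<in> X \<Longrightarrow> P (Q x) = c *\<^sub>R x" and "z \<in> complex_vector.span X"
  shows "P (Q z) = c *\<^sub>R z"
  using assms(4)
proof (induction rule: complex_vector.span_induct)
  show "complex_vector.subspace {z. P (Q z) = c *\<^sub>R z}"
    unfolding complex_vector.subspace_def using assms(1,2)
    by (simp add: clinear_op_def blinfun.bilinear_simps scaleR_scaleC scaleC_scaleC
        scaleC_add_right mult.commute)
qed (use assms(3) in simp)

text \<open>The principal vectors \<open>x\<^sub>k\<close>, \<open>y\<^sub>k\<close> all attain the bound \<open>s = cos \<theta>\<close> of the first maximum.
  Hence \<open>Q x\<^sub>k = \<langle>y\<^sub>k, x\<^sub>k\<rangle> y\<^sub>k\<close> and \<open>P y\<^sub>k = \<langle>x\<^sub>k, y\<^sub>k\<rangle> x\<^sub>k\<close>, so that \<open>PQ x\<^sub>k = s\<^sup>2 x\<^sub>k\<close> and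
  \<open>QP y\<^sub>k = s\<^sup>2 y\<^sub>k\<close>.  By dimension count the \<open>x\<^sub>k\<close> span \<open>V\<close> and the \<open>y\<^sub>k\<close> span \<open>W\<close>.\<close>

lemma isoclinic_compression:
  assumes "isoclinic m V (W :: 'a::chilbert_space set)"
    and P: "orth_projection_onto P V" and Q: "orth_projection_onto Q W"
  obtains c X Y where "0 \<le> c" "c \<le> 1"
    and "finite X" "orthonormal_set X" "complex_vector.span X = V"
    and "finite Y" "orthonormal_set Y" "complex_vector.span Y = W"
    and "\<And>z. P (Q (P z)) = c *\<^sub>R P z" "\<And>z. Q (P (Q z)) = c *\<^sub>R Q z"
proof -
  obtain \<theta> where m: "1 \<le> m"
    and V: "complex_vector.subspace V" "complex_vector.dim V = m"
    and W: "complex_vector.subspace W" "complex_vector.dim W = m"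
    and angles: "canonical_angles V W \<theta>"
    and eq: "\<forall>j\<in>{1..m}. \<forall>k\<in>{1..m}. \<theta> j = \<theta> k"
    using assms(1) unfolding isoclinic_def by blast
  obtain x y where "\<forall>k\<in>{1..m}. \<theta> k \<in> {0..pi/2} \<and>
        (x k, y k) \<in> angle_pairs V W x y k \<and>
        cos (\<theta> k) = cmod (cinner (x k) (y k)) \<and>
        (\<forall>(u, v)\<in>angle_pairs V W x y k. cmod (cinner u v) \<le> cos (\<theta> k))"
    using angles unfolding canonical_angles_def V(2) W(2) min.idem by (elim exE) (rule that)
  then have ang: "\<theta> k \<in> {0..pi/2}" "(x k, y k) \<in> angle_pairs V W x y k"
      "cos (\<theta> k) = cmod (cinner (x k) (y k))"
      "(u, v) \<in> angle_pairs V W x y k \<Longrightarrow> cmod (cinner u v) \<le> cos (\<theta> k)"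
    if "k \<in> {1..m}" for k u v
    using that by blast+
  define s where "s = cos (\<theta> 1)"
  have one: "1 \<in> {1..m}" using m by simp
  have s: "cos (\<theta> k) = s" if "k \<in> {1..m}" for k using eq that one unfolding s_def by metis
  have s0: "0 \<le> s" "s \<le> 1" using ang(1)[OF one] unfolding s_def by (auto intro: cos_ge_zero)
  have bound: "cmod (cinner u v) \<le> s" if "u \<in> V" "v \<in> W" "norm u = 1" "norm v = 1" for u v
    using ang(4)[OF one, of u v] that unfolding s_def angle_pairs_def by simp
  have xy: "x k \<in> V" "y k \<in> W" "norm (x k) = 1" "norm (y k) = 1" "cmod (cinner (x k) (y k)) = s"
    if "k \<in> {1..m}" for k
    using ang(2,3)[OF that] s[OF that] unfolding angle_pairs_def by simp_all
  have orth: "cinner (x j) (x k) = 0" "cinner (y j) (y k) = 0"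
    if "j \<in> {1..m}" "k \<in> {1..m}" "j \<noteq> k" for j k
  proof -
    have *: "cinner (x j) (x k) = 0 \<and> cinner (y j) (y k) = 0" if "1 \<le> j" "j < k" "k \<le> m" for j k
      using ang(2)[of k] that unfolding angle_pairs_def by simp
    then show "cinner (x j) (x k) = 0" "cinner (y j) (y k) = 0"
      using that by (metis atLeastAtMost_iff cinner_commute complex_cnj_zero linorder_neqE_nat)+
  qed
  have basis: "orthonormal_set (f ` {1..m})" "complex_vector.span (f ` {1..m}) = U"
    if f: "\<And>k. k \<in> {1..m} \<Longrightarrow> f k \<in> U \<and> norm (f k) = 1"
      "\<And>j k. j \<in> {1..m} \<Longrightarrow> k \<in> {1..m} \<Longrightarrow> j \<noteq> k \<Longrightarrow> cinner (f j) (f k) = 0"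
      and U: "complex_vector.subspace U" "complex_vector.dim U = m"
    for f :: "nat \<Rightarrow> 'a" and U
  proof -
    have unit: "cinner (f k) (f k) = 1" if "k \<in> {1..m}" for k
      using f(1)[OF that] by (simp add: cinner_self)
    have inj: "inj_on f {1..m}"
      using f(2) unit by (intro inj_onI) (metis zero_neq_one)
    show ON: "orthonormal_set (f ` {1..m})"
      unfolding orthonormal_set_def using f(2) unit by (auto; metis)
    show "complex_vector.span (f ` {1..m}) = U"
      using f(1) U m inj by (intro span_independent_eq orthonormal_independent[OF ON])
        (auto simp: card_image)
  qed
  have Qx: "Q (x k) = cinner (y k) (x k) *\<^sub>C y k" if "k \<in> {1..m}" for k
    using xy[OF that] bound s0 by (intro projection_attaining_bound[OF Q W(1), where s = s]) auto
  have Py: "P (y k) = cinner (x k) (y k) *\<^sub>C x k" if "k \<in> {1..m}" for k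
    using xy[OF that] bound s0
    by (intro projection_attaining_bound[OF P V(1), where s = s]) (auto, (metis cinner_commute complex_mod_cnj)+)
  have lin: "clinear_op P" "clinear_op Q" using P Q by (simp_all add: orth_projection_onto_def)
  have prod: "cinner (x k) (y k) * cinner (y k) (x k) = complex_of_real (s\<^sup>2)" if "k \<in> {1..m}" for k
    using xy(5)[OF that] cinner_commute[of "y k" "x k"] by (metis complex_norm_square of_real_power)
  have PQ: "P (Q z) = s\<^sup>2 *\<^sub>R z" if "z \<in> x ` {1..m}" for z
    using that lin prod by (auto simp: Qx Py clinear_op_def scaleC_scaleC scaleR_scaleC mult.commute)
  have QP: "Q (P z) = s\<^sup>2 *\<^sub>R z" if "z \<in> y ` {1..m}" for z
    using that lin prod by (auto simp: Qx Py clinear_op_def scaleC_scaleC scaleR_scaleC mult.commute)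
  have X: "orthonormal_set (x ` {1..m})" "complex_vector.span (x ` {1..m}) = V"
    using basis[of x V] xy orth V by auto
  have Y: "orthonormal_set (y ` {1..m})" "complex_vector.span (y ` {1..m}) = W"
    using basis[of y W] xy orth W by auto
  show thesis
  proof (rule that[OF _ _ _ X _ Y])
    show "0 \<le> s\<^sup>2" "s\<^sup>2 \<le> 1" using s0 by (simp_all add: power_le_one)
    show "P (Q (P z)) = s\<^sup>2 *\<^sub>R P z" for z
      using compression_eq_on_span[OF lin PQ] X(2) projection_range[OF P] by blast
    show "Q (P (Q z)) = s\<^sup>2 *\<^sub>R Q z" for z
      using compression_eq_on_span[OF lin(2,1) QP] Y(2) projection_range[OF Q] by blast
  qed auto
qed


section \<open>Recovery\<close>

text \<open>The recovery has the Kraus operators \<open>P\<close> and \<open>A = PQ(1 - P)/\<surd>(c(1 - c))\<close>.  They satisfy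
  \<open>P A\<^sup>* = 0\<close>, and \<open>A A\<^sup>*\<close> is \<open>P\<close>, or \<open>0\<close> in the degenerate cases below.  So \<open>P z\<close> and \<open>A\<^sup>* A z\<close> are
  the components of \<open>z\<close> in two orthogonal subspaces, which is why \<open>P\<close> and \<open>A\<close> form an error
  model.\<close>

lemma recovery_channel:
  fixes P Q :: "'a::chilbert_space \<Rightarrow>\<^sub>L 'a"
  assumes P: "orth_projection_onto P V" and Q: "orth_projection_onto Q W"
    and PQP: "\<And>z. P (Q (P z)) = c *\<^sub>R P z" and c: "0 \<le> c" "c \<le> 1"
  obtains R where "quantum_channel R"
    and "\<And>\<rho>. adjoint_pair \<rho> \<rho> \<Longrightarrow> range \<rho> \<subseteq> V \<Longrightarrow>
      R ((1/2) *\<^sub>R ((P o\<^sub>L \<rho> o\<^sub>L P) + (Q o\<^sub>L \<rho> o\<^sub>L Q))) = ((1 + c) / 2) *\<^sub>R \<rho>"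
proof -
  (* When c is 0 or 1, k is a division by zero, hence 0, and A = 0.  This is the right recovery:
     (1 - P)QP then vanishes, since PQ(1 - P)QP = 0, so both errors map the code into itself.  The
     identities kd hold in all cases. *)
  define d where "d = c * (1 - c)"
  have d0: "d \<ge> 0" using c by (simp add: d_def)
  define k where "k = 1 / sqrt d"
  define A where "A = k *\<^sub>R (P o\<^sub>L Q o\<^sub>L (id_blinfun - P))"
  define A' where "A' = k *\<^sub>R ((id_blinfun - P) o\<^sub>L (Q o\<^sub>L P))"
  define E where "E = (\<lambda>i::nat. if i = 0 then P else A)"
  note adjP = adjoint_pair_projection[OF P] and adjQ = adjoint_pair_projection[OF Q]
  have adjA: "adjoint_pair A A'"
    unfolding A_def A'_def
    by (intro adjoint_pair_scaleR adjoint_pair_compose adjoint_pair_diff adjoint_pair_id adjP adjQ)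
  have kd: "k * k * d \<le> 1" "k * k * (d * d) = d"
    using d0 by (auto simp: k_def)
  note idem = projection_idem[OF P] projection_idem[OF Q]
  have A_Q: "A (Q (P z)) = (k * d) *\<^sub>R P z" for z
    unfolding A_def d_def by (simp add: blinfun.bilinear_simps idem PQP algebra_simps)
  have A_P: "A (P z) = 0" for z unfolding A_def by (simp add: blinfun.bilinear_simps idem)
  have P_A': "P (A' z) = 0" for z unfolding A'_def by (simp add: blinfun.bilinear_simps idem)
  have AA': "A (A' z) = (k * k * d) *\<^sub>R P z" for z
    unfolding A'_def by (simp add: blinfun.bilinear_simps A_Q A_P mult.assoc)
  have contr: "(norm (P z))\<^sup>2 + (norm (A z))\<^sup>2 \<le> (norm z)\<^sup>2" for z
  proof -
    define w where "w = A' (A z)"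
    have "cinner (P z) w = 0" using projection_cinner[OF P] by (simp add: w_def P_A')
    then have *: "(norm (P z + w))\<^sup>2 = (norm (P z))\<^sup>2 + (norm w)\<^sup>2" by (rule pythagoras)
    have "cinner w w = cinner (A z) (A w)"
      using adjoint_pair_swap[OF adjA] unfolding w_def adjoint_pair_def by metis
    also have "\<dots> = of_real (k * k * d) * cinner (A z) (P (A z))"
      by (simp add: w_def AA' cinner_simps)
    also have "P (A z) = A z" unfolding A_def by (simp add: blinfun.bilinear_simps idem)
    finally have "complex_of_real ((norm w)\<^sup>2) = complex_of_real (k * k * d * (norm (A z))\<^sup>2)"
      by (simp add: cinner_self)
    then have "(norm w)\<^sup>2 = k * k * d * (norm (A z))\<^sup>2" by (simp only: of_real_eq_iff)
    also have "\<dots> \<le> (norm (A z))\<^sup>2" using kd(1) by (simp add: mult_left_le_one_le k_def d0)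
    finally have w: "(norm w)\<^sup>2 \<le> (norm (A z))\<^sup>2" .
    have zPz: "cinner z (P z) = of_real ((norm (P z))\<^sup>2)"
      using norm_adjoint[OF adjP, of z] by (simp add: idem)
    have zw: "cinner z w = of_real ((norm (A z))\<^sup>2)"
      unfolding w_def by (rule norm_adjoint[OF adjA])
    (* Bessel's inequality for the component P z + w of z, from the nonnegativity of the squared
       distance between z and P z + w. *)
    have "complex_of_real ((norm (z - (P z + w)))\<^sup>2) = cinner z z - cinner z (P z + w)
       - cnj (cinner z (P z + w)) + cinner (P z + w) (P z + w)"
      using cinner_commute[of "P z + w" z] unfolding cinner_self[symmetric] by (simp add: cinner_simps)
    also have "\<dots> = complex_of_real ((norm z)\<^sup>2 - 2 * ((norm (P z))\<^sup>2 + (norm (A z))\<^sup>2)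
        + (norm (P z))\<^sup>2 + (norm w)\<^sup>2)"
      unfolding cinner_self * cinner_add_right[of z] zPz zw by simp
    finally have "(norm (z - (P z + w)))\<^sup>2 = (norm z)\<^sup>2 - 2 * ((norm (P z))\<^sup>2 + (norm (A z))\<^sup>2)
        + (norm (P z))\<^sup>2 + (norm w)\<^sup>2" by (simp only: of_real_eq_iff)
    moreover have "0 \<le> (norm (z - (P z + w)))\<^sup>2" by simp
    ultimately have "0 \<le> (norm z)\<^sup>2 - 2 * ((norm (P z))\<^sup>2 + (norm (A z))\<^sup>2)
        + (norm (P z))\<^sup>2 + (norm w)\<^sup>2" by metis
    then show ?thesis using w by argo
  qed
  have "error_model {0, 1} E"
    by (rule error_modelI[where E' = "\<lambda>i. if i = 0 then P else A'"])
      (use adjP adjA contr in \<open>auto simp: E_def\<close>)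
  then have channel: "quantum_channel (kraus_map {0, 1} E)" unfolding quantum_channel_def by blast
  show thesis
  proof (rule that[OF channel])
    fix \<rho> :: "'a \<Rightarrow>\<^sub>L 'a" assume \<rho>: "adjoint_pair \<rho> \<rho>" "range \<rho> \<subseteq> V"
    note P\<rho> = supported_absorbs_projection(1)[OF P \<rho>(1,2)]
      and \<rho>P = supported_absorbs_projection(2)[OF P \<rho>(1,2)]
    have A\<rho>: "A (\<rho> z) = 0" for z using A_P[of "\<rho> z"] by (simp add: P\<rho>)
    have AQ\<rho>: "A (Q (\<rho> z)) = (k * d) *\<^sub>R \<rho> z" for z using A_Q[of "\<rho> z"] by (simp add: P\<rho>)
    have PQ\<rho>: "P (Q (\<rho> z)) = c *\<^sub>R \<rho> z" for z using PQP[of "\<rho> z"] by (simp add: P\<rho>)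
    have \<rho>QP: "\<rho> (Q (P z)) = c *\<^sub>R \<rho> z" for z
      using arg_cong[OF PQP[of z], of "blinfun_apply \<rho>"] by (simp add: \<rho>P blinfun.bilinear_simps)
    have \<rho>QA': "\<rho> (Q (A' z)) = (k * d) *\<^sub>R \<rho> z" for z
      unfolding A'_def d_def
      by (simp add: blinfun.bilinear_simps \<rho>QP idem PQP \<rho>P algebra_simps)
    have kraus: "kraus_map {0, 1} E \<sigma> = (P o\<^sub>L \<sigma> o\<^sub>L P) + (A o\<^sub>L \<sigma> o\<^sub>L A')" for \<sigma>
      using kraus_map_pair[of 0 1 E P A'] adjP adjA by (simp add: E_def)
    have "k * d * (k * d) = d" using kd(2) by (simp add: algebra_simps)
    then have weight: "1 / 2 + 1 / 2 * (c * c) + 1 / 2 * (k * d * (k * d)) = (1 + c) / 2"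
      by (simp add: d_def field_simps)
    show "kraus_map {0, 1} E ((1/2) *\<^sub>R ((P o\<^sub>L \<rho> o\<^sub>L P) + (Q o\<^sub>L \<rho> o\<^sub>L Q)))
        = ((1 + c) / 2) *\<^sub>R \<rho>"
    proof (rule blinfun_eqI)
      fix z
      have "P (Q (\<rho> (Q (P z)))) = (c * c) *\<^sub>R \<rho> z"
        "A (Q (\<rho> (Q (A' z)))) = (k * d * (k * d)) *\<^sub>R \<rho> z"
        by (simp_all add: blinfun.bilinear_simps PQ\<rho> \<rho>QP AQ\<rho> \<rho>QA')
      then have "kraus_map {0, 1} E ((1/2) *\<^sub>R ((P o\<^sub>L \<rho> o\<^sub>L P) + (Q o\<^sub>L \<rho> o\<^sub>L Q))) z
        = (1 / 2) *\<^sub>R (\<rho> z + (c * c) *\<^sub>R \<rho> z) + (1 / 2) *\<^sub>R (k * d * (k * d)) *\<^sub>R \<rho> z"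
        unfolding kraus by (simp add: blinfun.bilinear_simps P\<rho> \<rho>P A\<rho> P_A')
      also have "\<dots> = (1 / 2 + 1 / 2 * (c * c) + 1 / 2 * (k * d * (k * d))) *\<^sub>R \<rho> z"
        by (simp only: scaleR_add_left scaleR_add_right scaleR_scaleR)
      finally show "kraus_map {0, 1} E ((1/2) *\<^sub>R ((P o\<^sub>L \<rho> o\<^sub>L P) + (Q o\<^sub>L \<rho> o\<^sub>L Q))) z
        = (((1 + c) / 2) *\<^sub>R \<rho>) z"
        unfolding weight by (simp add: blinfun.bilinear_simps)
    qed
  qed
qed

text \<open>With an orthonormal basis \<open>X\<close> of the code, \<open>\<rho> = \<Sum>\<^sub>x |\<rho> x\<rangle>\<langle>x|\<close> and
  \<open>Q\<rho>Q = \<Sum>\<^sub>x |Q\<rho> x\<rangle>\<langle>Q x|\<close> have finite rank, and \<open>\<langle>Q x, Q\<rho> x\<rangle> = \<langle>x, PQP \<rho> x\<rangle> = c \<langle>x, \<rho> x\<rangle>\<close>.\<close>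

lemma trace_projected_state:
  fixes P Q :: "'a::chilbert_space \<Rightarrow>\<^sub>L 'a"
  assumes P: "orth_projection_onto P V" and Q: "orth_projection_onto Q W"
    and PQP: "\<And>z. P (Q (P z)) = c *\<^sub>R P z"
    and X: "finite X" "orthonormal_set X" "complex_vector.span X = V"
    and \<rho>: "adjoint_pair \<rho> \<rho>" "range \<rho> \<subseteq> V" "has_trace \<rho> t"
  shows "has_trace ((1/2) *\<^sub>R ((P o\<^sub>L \<rho> o\<^sub>L P) + (Q o\<^sub>L \<rho> o\<^sub>L Q))) (of_real ((1 + c) / 2) * t)"
proof -
  obtain B where B: "orthonormal_basis B" "((\<lambda>e. cinner e (\<rho> e)) has_sum t) B"
    using \<rho>(3) unfolding has_trace_def by blast
  note P\<rho> = supported_absorbs_projection(1)[OF P \<rho>(1,2)]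
    and \<rho>P = supported_absorbs_projection(2)[OF P \<rho>(1,2)]
  have Px: "P x = x" if "x \<in> X" for x
    using that X(3) projection_fixes[OF P] complex_vector.span_base by blast
  have lin: "clinear_op \<rho>" "clinear_op Q"
    using \<rho>(1) Q by (simp_all add: adjoint_pair_def orth_projection_onto_def)
  have exp: "\<rho> z = (\<Sum>x\<in>X. cinner x z *\<^sub>C \<rho> x)" for z
  proof -
    have "(\<Sum>x\<in>X. cinner x (P z) *\<^sub>C x) = P z"
      using X projection_range[OF P] by (intro orthonormal_expansion) auto
    moreover have "cinner x (P z) = cinner x z" if "x \<in> X" for x
      using projection_cinner[OF P, of x z] Px[OF that] by simp
    ultimately have "P z = (\<Sum>x\<in>X. cinner x z *\<^sub>C x)" by simp
    then have "\<rho> z = \<rho> (\<Sum>x\<in>X. cinner x z *\<^sub>C x)" using \<rho>P[of z] by simp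
    then show ?thesis using lin by (simp add: blinfun.sum_right clinear_op_def)
  qed
  have t: "t = (\<Sum>x\<in>X. cinner x (\<rho> x))"
    using has_sum_unique[OF B(2) trace_finite_rank[OF B(1) X(1) exp]] .
  have expQ: "(Q o\<^sub>L \<rho> o\<^sub>L Q) z = (\<Sum>x\<in>X. cinner (Q x) z *\<^sub>C Q (\<rho> x))" for z
    using lin by (simp add: exp[of "Q z"] blinfun.sum_right clinear_op_def projection_cinner[OF Q])
  have "cinner (Q x) (Q (\<rho> x)) = of_real c * cinner x (\<rho> x)" if "x \<in> X" for x
  proof -
    have "cinner (Q x) (Q (\<rho> x)) = cinner (P x) (Q (\<rho> x))"
      by (simp add: projection_cinner[OF Q] projection_idem[OF Q] Px[OF that])
    also have "\<dots> = cinner x (P (Q (P (\<rho> x))))" by (simp add: projection_cinner[OF P] P\<rho>)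
    also have "P (Q (P (\<rho> x))) = c *\<^sub>R \<rho> x" using PQP[of "\<rho> x"] by (simp only: P\<rho>)
    finally show ?thesis by (simp add: cinner_simps)
  qed
  then have "(\<Sum>x\<in>X. cinner (Q x) (Q (\<rho> x))) = of_real c * t"
    by (simp add: t sum_distrib_left)
  with trace_finite_rank[OF B(1) X(1) expQ]
  have "((\<lambda>e. cinner e ((Q o\<^sub>L \<rho> o\<^sub>L Q) e)) has_sum of_real c * t) B" by simp
  from has_sum_cmult_right[OF has_sum_add[OF B(2) this], of "1/2"]
  have "((\<lambda>e. cinner e (((1/2) *\<^sub>R ((P o\<^sub>L \<rho> o\<^sub>L P) + (Q o\<^sub>L \<rho> o\<^sub>L Q))) e))
      has_sum of_real ((1 + c) / 2) * t) B"
    by (simp add: blinfun.bilinear_simps cinner_simps P\<rho> \<rho>P algebra_simps add_divide_distrib)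
  then show ?thesis using B(1) unfolding has_trace_def by blast
qed

lemma correctable_range:
  fixes P Q :: "'a::chilbert_space \<Rightarrow>\<^sub>L 'a"
  assumes P: "orth_projection_onto P V" and Q: "orth_projection_onto Q W"
    and PQP: "\<And>z. P (Q (P z)) = c *\<^sub>R P z" and c: "0 \<le> c" "c \<le> 1"
    and X: "finite X" "orthonormal_set X" "complex_vector.span X = V"
    and \<Phi>: "quantum_channel \<Phi>" "\<And>\<rho>. \<Phi> \<rho> = (1/2) *\<^sub>R ((P o\<^sub>L \<rho> o\<^sub>L P) + (Q o\<^sub>L \<rho> o\<^sub>L Q))"
  shows "correctable V \<Phi>"
proof -
  obtain R where R: "quantum_channel R"
    and rec: "\<And>\<rho>. adjoint_pair \<rho> \<rho> \<Longrightarrow> range \<rho> \<subseteq> V \<Longrightarrow> R (\<Phi> \<rho>) = ((1 + c) / 2) *\<^sub>R \<rho>"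
    using recovery_channel[OF P Q PQP c] unfolding \<Phi>(2) by metis
  have "\<exists>t>0. has_trace (\<Phi> \<rho>) (complex_of_real t) \<and> (R \<circ> \<Phi>) \<rho> = t *\<^sub>R \<rho>"
    if \<rho>: "density_operator \<rho> \<and> supported_on \<rho> V" for \<rho>
  proof (intro exI conjI)
    have sa: "adjoint_pair \<rho> \<rho>" and r: "range \<rho> \<subseteq> V" and tr: "has_trace \<rho> 1"
      using \<rho> positive_op_selfadjoint by (auto simp: density_operator_def supported_on_def)
    show "0 < (1 + c) / 2" using c by simp
    show "has_trace (\<Phi> \<rho>) (complex_of_real ((1 + c) / 2))"
      using trace_projected_state[OF P Q PQP X sa r tr] unfolding \<Phi>(2) by simp
    show "(R \<circ> \<Phi>) \<rho> = ((1 + c) / 2) *\<^sub>R \<rho>" using rec[OF sa r] by simp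
  qed
  then show ?thesis
    unfolding correctable_def using R \<Phi>(1) X(3) complex_vector.subspace_span[of X] by blast
qed

lemma half_projections_error_model:
  fixes P :: "nat \<Rightarrow> ('a::chilbert_space \<Rightarrow>\<^sub>L 'a)"
  assumes "\<And>i. i \<in> {1, 2} \<Longrightarrow> orth_projection_onto (P i) (V i)"
  shows "error_model {1, 2} (\<lambda>i. (1 / sqrt 2) *\<^sub>R P i)"
proof (rule error_modelI[where E' = "\<lambda>i. (1 / sqrt 2) *\<^sub>R P i"])
  show "adjoint_pair ((1 / sqrt 2) *\<^sub>R P i) ((1 / sqrt 2) *\<^sub>R P i)" if "i \<in> {1, 2}" for i
    by (rule adjoint_pair_scaleR[OF adjoint_pair_projection[OF assms[OF that]]])
  fix x
  have "(norm (P i x))\<^sup>2 \<le> (norm x)\<^sup>2" if "i \<in> {1, 2}" for i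
    by (rule power_mono[OF projection_contraction[OF assms[OF that]] norm_ge_zero])
  note le = this[of 1] this[of 2]
  have "(norm (P 1 x))\<^sup>2 / 2 + (norm (P 2 x))\<^sup>2 / 2 \<le> (norm x)\<^sup>2" using le by (simp only: insert_iff simp_thms) argo
  then show "(\<Sum>i\<in>{1, 2}. (norm (((1 / sqrt 2) *\<^sub>R P i) x))\<^sup>2) \<le> (norm x)\<^sup>2"
    by (simp add: blinfun.bilinear_simps power_divide)
qed simp

theorem proposition8:
  fixes P :: "nat \<Rightarrow> ('a::chilbert_space \<Rightarrow>\<^sub>L 'a)" and V :: "nat \<Rightarrow> 'a set" and m :: nat
  assumes "isoclinic m (V 1) (V 2)"
    and "orth_projection_onto (P 1) (V 1)"
    and "orth_projection_onto (P 2) (V 2)"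
  shows "correctable_for_error_model (range (P 1)) {1, 2} (\<lambda>i. (1 / sqrt 2) *\<^sub>R P i) \<and>
         correctable_for_error_model (range (P 2)) {1, 2} (\<lambda>i. (1 / sqrt 2) *\<^sub>R P i)"
proof -
  let ?E = "\<lambda>i. (1 / sqrt 2) *\<^sub>R P i"
  have em: "error_model {1, 2} ?E"
    by (rule half_projections_error_model[where V = V]) (use assms in auto)
  then have ch: "quantum_channel (kraus_map {1, 2} ?E)" unfolding quantum_channel_def by blast
  have adj: "adjoint_pair (?E i) (?E i)" if "i \<in> {1, 2}" for i
    using that assms adjoint_pair_projection by (auto intro!: adjoint_pair_scaleR)
  have \<Phi>: "kraus_map {1, 2} ?E \<rho> = (1/2) *\<^sub>R ((P 1 o\<^sub>L \<rho> o\<^sub>L P 1) + (P 2 o\<^sub>L \<rho> o\<^sub>L P 2))" for \<rho>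
    using kraus_map_pair[of 1 2 ?E "?E 1" "?E 2"] adj
    by (intro blinfun_eqI) (simp add: blinfun.bilinear_simps scaleR_add_right)
  obtain c X Y where c: "0 \<le> c" "c \<le> 1"
    and X: "finite X" "orthonormal_set X" "complex_vector.span X = V 1"
    and Y: "finite Y" "orthonormal_set Y" "complex_vector.span Y = V 2"
    and PQ: "\<And>z. P 1 (P 2 (P 1 z)) = c *\<^sub>R P 1 z" "\<And>z. P 2 (P 1 (P 2 z)) = c *\<^sub>R P 2 z"
    using isoclinic_compression[OF assms] by metis
  have "correctable (V 1) (kraus_map {1, 2} ?E)"
    by (rule correctable_range[OF assms(2,3) PQ(1) c X ch \<Phi>])
  moreover have "correctable (V 2) (kraus_map {1, 2} ?E)"
    by (rule correctable_range[OF assms(3,2) PQ(2) c Y ch]) (simp only: \<Phi> add.commute)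
  moreover have "range (P 1) = V 1" "range (P 2) = V 2"
    using assms by (simp_all add: orth_projection_onto_def)
  ultimately show ?thesis using em by (simp add: correctable_for_error_model_def)
qed

end
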